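(* Let $n\ge 2$ and let $j\in\{0,1,\ldots,2^n-1\}$ be an odd integer with $n$-bit representation $j=(x,1)$, where $x=(x_{n-2},\ldots,x_0)\in\{0,1\}^{n-1}$ and $x\ne \mathbf{1}_{n-1}$ (the all-one string). Then the adjacent transposition $s_j=(j,j+1)$ of the set $\{0,1,\ldots,2^n-1\}$ is implemented by the unitary gate $$U_x\,T^{(n)}_{x+1}\,U_x ,$$ that is, $U_xT^{(n)}_{x+1}U_x$ interchanges $|j\rangle_n$ and $|j+1\rangle_n$ and fixes every other canonical basis vector of $\mathbb{C}^{2^n}$.
   Context: The canonical basis of $\mathbb{C}^{2^n}=(\mathbb{C}^2)^{\otimes n}$ is $\{|q\rangle_n=|q_{n-1}\cdots q_1q_0\rangle_n : q_j\in\{0,1\}\}$, where $q=\sum_{j=0}^{n-1}q_j2^j$; the bit $q_j$ is the state of the $(n-j)$-th qubit. A bit string $x=(x_{n-2},\ldots,x_0)$ is identified with the integer $\sum_{i=0}^{n-2}x_i2^i$, so $j=(x,1)$ means $j=2x+1$. $X$ is the Pauli (NOT) matrix. For $y\in\{0,\ldots,2^{n-1}-1\}$ with $(n-1)$-bit representation $(y_{n-2},\ldots,y_0)$, the generalized Toffoli gate $T^{(n)}_y$ is the linear map on $\mathbb{C}^{2^n}$ with $T^{(n)}_y|q_{n-1}\cdots q_1q_0\rangle_n=|q_{n-1}\cdots q_1\rangle_{n-1}\otimes(X|q_0\rangle_1)$ if $(y_{n-2},\ldots,y_0)=(q_{n-1},\ldots,q_1)$, and $T^{(n)}_y|q\rangle_n=|q\rangle_n$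 otherwise. $X_{kl}$ denotes the CNOT gate with the $k$-th qubit as control and the $l$-th qubit as target. Let $x+1$ have $(n-1)$-bit representation $(y_{n-2},\ldots,y_0)$ and let $\mathcal{I}=\{i\in\{0,\ldots,n-2\}: y_i\ne x_i\}$, so $|\mathcal{I}|$ is the Hamming distance between $x$ and $x+1$. Then $U_x=X_{n(n-1)}$ if $x$ is even, and $U_x=\prod_{i\in\mathcal{I}}X_{n(n-i-1)}$ if $x$ is odd (these CNOT gates commute). *)

theory Defs
  imports
    Complex_Main
    "HOL-Combinatorics.Transposition"
    "Jordan_Normal_Form.Matrix"
    "Jordan_Normal_Form.Schur_Decomposition"
begin

text \<open>
  The space of \<open>n\<close> qubits is the space of complex vectors of dimension \<open>2 ^ n\<close>; a bit string
  \<open>(q\<^sub>n\<^sub>-\<^sub>1, \<dots>, q\<^sub>0)\<close> is identified with the natural number \<open>q\<close> such that \<open>bit q j\<close> is \<open>q\<^sub>j\<close>.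
  Bit \<open>j\<close> is the state of qubit \<open>n - j\<close>; hence qubit \<open>k\<close> (with \<open>1 \<le> k \<le> n\<close>) is bit \<open>n - k\<close>.
\<close>

definition ket :: "nat \<Rightarrow> nat \<Rightarrow> complex vec" where
  "ket n q = unit_vec (2 ^ n) q"

definition tensor_vec :: "complex vec \<Rightarrow> complex vec \<Rightarrow> complex vec" (infixl "\<otimes>\<^sub>v" 70) where
  "v \<otimes>\<^sub>v w = vec (dim_vec v * dim_vec w) (\<lambda>i. v $ (i div dim_vec w) * w $ (i mod dim_vec w))"

definition linear_extension :: "nat \<Rightarrow> (nat \<Rightarrow> complex vec) \<Rightarrow> complex mat" where
  "linear_extension n f = mat_of_cols (2 ^ n) (map f [0..<2 ^ n])"

definition pauli_X :: "complex mat" where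
  "pauli_X = mat_of_rows_list 2 [[0, 1], [1, 0]]"

text \<open>
  As numbers, \<open>(q\<^sub>n\<^sub>-\<^sub>1, \<dots>, q\<^sub>1)\<close> is \<open>q div 2\<close> and \<open>q\<^sub>0\<close> is \<open>q mod 2\<close>.
\<close>

definition toffoli :: "nat \<Rightarrow> nat \<Rightarrow> complex mat" where
  "toffoli n y = linear_extension n (\<lambda>q.
     if \<forall>i<n - 1. bit y i = bit q (Suc i)
     then ket (n - 1) (q div 2) \<otimes>\<^sub>v (pauli_X *\<^sub>v ket 1 (q mod 2))
     else ket n q)"

definition cnot :: "nat \<Rightarrow> nat \<Rightarrow> nat \<Rightarrow> complex mat" where
  "cnot n k l = linear_extension n (\<lambda>q.
     ket n (if bit q (n - k) then flip_bit (n - l) q else q))"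

definition differing_bits :: "nat \<Rightarrow> nat \<Rightarrow> nat set" where
  "differing_bits n x = {i. i < n - 1 \<and> bit (x + 1) i \<noteq> bit x i}"

text \<open>
  The factors of the product are taken in increasing order of \<open>i\<close>; the order is immaterial by
  \<open>cnot_commute\<close> below.
\<close>

definition U_gate :: "nat \<Rightarrow> nat \<Rightarrow> complex mat" where
  "U_gate n x =
     (if even x then cnot n n (n - 1)
      else foldr (*) (map (\<lambda>i. cnot n n (n - i - 1)) (sorted_list_of_set (differing_bits n x)))
             (1\<^sub>m (2 ^ n)))"

definition unitary_gate :: "nat \<Rightarrow> complex mat \<Rightarrow> bool" where
  "unitary_gate n G \<longleftrightarrow>
     G \<in> carrier_mat (2 ^ n) (2 ^ n) \<and> G * mat_adjoint G = 1\<^sub>m (2 ^ n) \<and>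
     mat_adjoint G * G = 1\<^sub>m (2 ^ n)"

definition implements :: "nat \<Rightarrow> complex mat \<Rightarrow> (nat \<Rightarrow> nat) \<Rightarrow> bool" where
  "implements n G \<sigma> \<longleftrightarrow> (\<forall>q<2 ^ n. G *\<^sub>v ket n q = ket n (\<sigma> q))"

lemma ket_carrier [simp]: "ket n q \<in> carrier_vec (2 ^ n)"
  by (simp add: ket_def)

lemma linear_extension_carrier [simp]:
  "linear_extension n f \<in> carrier_mat (2 ^ n) (2 ^ n)"
  using mat_of_cols_carrier(1)[of "2 ^ n" "map f [0..<2 ^ n]"]
  by (simp add: linear_extension_def)

lemma mat_mult_ket:
  assumes "A \<in> carrier_mat (2 ^ n) (2 ^ n)" "q < 2 ^ n"
  shows "A *\<^sub>v ket n q = col A q"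
  using assms by (intro eq_vecI) (auto simp: ket_def)

lemma linear_extension_ket:
  assumes "q < 2 ^ n" "f q \<in> carrier_vec (2 ^ n)"
  shows "linear_extension n f *\<^sub>v ket n q = f q"
proof -
  have "linear_extension n f *\<^sub>v ket n q = col (linear_extension n f) q"
    by (simp add: mat_mult_ket assms)
  also have "\<dots> = f q"
    unfolding linear_extension_def using assms by (subst col_mat_of_cols) auto
  finally show ?thesis .
qed

lemma tensor_ket:
  assumes "a < 2 ^ m" "b < 2 ^ k"
  shows "ket m a \<otimes>\<^sub>v ket k b = ket (m + k) (a * 2 ^ k + b)"
proof (rule eq_vecI)
  show "dim_vec (ket m a \<otimes>\<^sub>v ket k b) = dim_vec (ket (m + k) (a * 2 ^ k + b))"
    by (simp add: ket_def tensor_vec_def power_add)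
  fix i assume "i < dim_vec (ket (m + k) (a * 2 ^ k + b))"
  then have i: "i < 2 ^ m * 2 ^ k" by (simp add: ket_def power_add)
  have d: "i div 2 ^ k < 2 ^ m" using i by (simp add: less_mult_imp_div_less)
  have "i div 2 ^ k = a \<and> i mod 2 ^ k = b" if "i = a * 2 ^ k + b"
    using that assms(2) by simp
  moreover have "i = a * 2 ^ k + b" if "i div 2 ^ k = a" "i mod 2 ^ k = b"
    using that div_mult_mod_eq[of i "2 ^ k"] by simp
  ultimately have "i = a * 2 ^ k + b \<longleftrightarrow> i div 2 ^ k = a \<and> i mod 2 ^ k = b"
    by blast
  moreover have "a * 2 ^ k + b < 2 ^ m * 2 ^ k"
  proof -
    have "a * 2 ^ k + b < Suc a * 2 ^ k" using assms(2) by simp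
    also have "\<dots> \<le> 2 ^ m * 2 ^ k" using assms(1) by (intro mult_right_mono) auto
    finally show ?thesis .
  qed
  ultimately show "(ket m a \<otimes>\<^sub>v ket k b) $ i = ket (m + k) (a * 2 ^ k + b) $ i"
    using i d assms by (auto simp: ket_def tensor_vec_def power_add unit_vec_def)
qed

lemma flip_bit_less:
  assumes "q < 2 ^ n" "i < n"
  shows "flip_bit i q < (2::nat) ^ n"
proof -
  have "take_bit n q = q" using assms by (simp add: take_bit_nat_eq_self)
  then have q: "bit q k \<longleftrightarrow> k < n \<and> bit q k" for k
    by (metis bit_take_bit_iff)
  have "take_bit n (flip_bit i q) = flip_bit i q"
  proof (rule bit_eqI)
    fix k
    show "bit (take_bit n (flip_bit i q)) k = bit (flip_bit i q) k"
      using q[of k] assms(2) unfolding bit_take_bit_iff bit_flip_bit_iff by auto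
  qed
  then show ?thesis by (simp add: take_bit_nat_eq_self_iff)
qed

lemma cnot_carrier [simp]: "cnot n k l \<in> carrier_mat (2 ^ n) (2 ^ n)"
  by (simp add: cnot_def)

lemma cnot_ket:
  "q < 2 ^ n \<Longrightarrow>
   cnot n k l *\<^sub>v ket n q = ket n (if bit q (n - k) then flip_bit (n - l) q else q)"
  by (simp add: cnot_def linear_extension_ket)

lemma cnot_commute:
  assumes "1 \<le> k" "k \<le> n" "1 \<le> l" "l \<le> n" "1 \<le> m" "m \<le> n" "l \<noteq> k" "m \<noteq> k"
  shows "cnot n k l * cnot n k m = cnot n k m * cnot n k l"
proof -
  have comm: "flip_bit a (flip_bit b q) = flip_bit b (flip_bit a q)" for a b q :: nat
    by (rule bit_eqI) (auto simp: bit_flip_bit_iff)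
  have ket: "(cnot n k l * cnot n k m) *\<^sub>v ket n q = (cnot n k m * cnot n k l) *\<^sub>v ket n q"
    if q: "q < 2 ^ n" for q
  proof -
    have "n - l \<noteq> n - k" "n - m \<noteq> n - k" using assms by auto
    moreover have "flip_bit (n - l) q < 2 ^ n" "flip_bit (n - m) q < 2 ^ n"
      using assms q by (auto intro!: flip_bit_less)
    ultimately show ?thesis
      using q comm[of "n - l" "n - m" q]
      by (simp add: assoc_mult_mat_vec[OF cnot_carrier cnot_carrier ket_carrier]
        cnot_ket bit_flip_bit_iff)
  qed
  show ?thesis
  proof (rule mat_col_eqI)
    fix i assume "i < dim_col (cnot n k m * cnot n k l)"
    then have "i < 2 ^ n" using cnot_carrier[of n k l] by auto
    then show "col (cnot n k l * cnot n k m) i = col (cnot n k m * cnot n k l) i"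
      using ket[of i] mat_mult_ket mult_carrier_mat[OF cnot_carrier cnot_carrier] by metis
  qed (simp_all add: carrier_matD[OF cnot_carrier])
qed

end

theory Submission
  imports Defs
begin

text \<open>
  All gates involved permute the canonical basis. The gate \<open>U\<^sub>x\<close> fixes the even labels and sends
  \<open>2 z + 1\<close> to \<open>2 (z XOR m) + 1\<close> with \<open>m = x XOR (x + 1)\<close>, so it is an involution carrying \<open>j = 2 x + 1\<close> to
  \<open>2 (x + 1) + 1\<close>. Conjugating the transposition \<open>(2 (x + 1), 2 (x + 1) + 1)\<close> performed by the Toffoli
  gate therefore yields the transposition \<open>(j + 1, j)\<close>.
\<close>

section \<open>Gates that permute the canonical basis\<close>

lemma implements_mult:
  assumes "A \<in> carrier_mat (2 ^ n) (2 ^ n)" "B \<in> carrier_mat (2 ^ n) (2 ^ n)"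
    and "implements n A \<sigma>" "implements n B \<tau>" "\<And>q. q < 2 ^ n \<Longrightarrow> \<tau> q < 2 ^ n"
  shows "implements n (A * B) (\<sigma> \<circ> \<tau>)"
  using assms by (auto simp: implements_def assoc_mult_mat_vec[OF assms(1,2) ket_carrier])

text \<open>By injectivity the columns of \<open>G\<close> are distinct basis vectors, hence
  orthonormal.\<close>

lemma unitary_gate_of_implements:
  assumes G: "G \<in> carrier_mat (2 ^ n) (2 ^ n)" and impl: "implements n G \<sigma>"
    and less: "\<And>q. q < 2 ^ n \<Longrightarrow> \<sigma> q < 2 ^ n" and inj: "inj_on \<sigma> {..<2 ^ n}"
  shows "unitary_gate n G"
proof -
  have col: "col G q = ket n (\<sigma> q)" if "q < 2 ^ n" for q
    using that impl mat_mult_ket[OF G that] by (simp add: implements_def)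
  have ent: "G $$ (r, q) = (if r = \<sigma> q then 1 else 0)" if "r < 2 ^ n" "q < 2 ^ n" for r q
  proof -
    have "G $$ (r, q) = col G q $ r" using that G by simp
    then show ?thesis using that less by (simp add: col ket_def)
  qed
  have adj: "mat_adjoint G \<in> carrier_mat (2 ^ n) (2 ^ n)"
    using G by (auto simp: mat_adjoint_def)
  have "mat_adjoint G * G = 1\<^sub>m (2 ^ n)"
  proof (rule eq_matI)
    fix i k assume "i < dim_row (1\<^sub>m (2 ^ n) :: complex mat)" "k < dim_col (1\<^sub>m (2 ^ n) :: complex mat)"
    then have ik: "i < 2 ^ n" "k < 2 ^ n" by simp_all
    have "(mat_adjoint G * G) $$ (i, k) = (\<Sum>r = 0..<2 ^ n. cnj (G $$ (r, i)) * G $$ (r, k))"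
      using ik G adj
      by (simp add: scalar_prod_def mat_adjoint_def mat_of_rows_def conjugate_vec_def)
    also have "\<dots> = (\<Sum>r = 0..<2 ^ n. if r = \<sigma> i then (if \<sigma> i = \<sigma> k then 1 else 0) else 0)"
      using ik by (intro sum.cong) (auto simp: ent)
    also have "\<dots> = (if \<sigma> i = \<sigma> k then 1 else 0)"
      using less[OF ik(1)] by simp
    also have "\<dots> = 1\<^sub>m (2 ^ n) $$ (i, k)"
      using ik inj by (auto simp: inj_on_def)
    finally show "(mat_adjoint G * G) $$ (i, k) = 1\<^sub>m (2 ^ n) $$ (i, k)" .
  qed (use G adj in auto)
  \<comment> \<open>For square matrices a left inverse is also a right inverse.\<close>
  moreover from this have "G * mat_adjoint G = 1\<^sub>m (2 ^ n)"
    using mat_mult_left_right_inverse[OF adj G] by simp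
  ultimately show ?thesis
    using G by (simp add: unitary_gate_def)
qed

section \<open>The Toffoli gate on basis labels\<close>

lemma pauli_X_ket:
  assumes "b < 2"
  shows "pauli_X *\<^sub>v ket 1 b = ket 1 (1 - b)"
proof -
  have "pauli_X \<in> carrier_mat (2 ^ 1) (2 ^ 1)"
    by (auto simp: pauli_X_def mat_of_rows_list_def)
  then have "pauli_X *\<^sub>v ket 1 b = col pauli_X b"
    using mat_mult_ket assms by simp
  also have "\<dots> = ket 1 (1 - b)"
    using assms
    by (intro eq_vecI)
      (auto simp: pauli_X_def mat_of_rows_list_def ket_def less_2_cases_iff)
  finally show ?thesis .
qed

lemma nat_eq_iff_low_bits:
  fixes a b :: nat
  assumes "a < 2 ^ m" "b < 2 ^ m"
  shows "a = b \<longleftrightarrow> (\<forall>i<m. bit a i = bit b i)"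
proof
  assume *: "\<forall>i<m. bit a i = bit b i"
  have "take_bit m a = take_bit m b"
    by (rule bit_eqI) (use * in \<open>auto simp: bit_take_bit_iff\<close>)
  then show "a = b" using assms by (simp add: take_bit_nat_eq_self)
qed simp

text \<open>Both \<open>y\<close> and \<open>q div 2\<close> have at most \<open>n - 1\<close> bits,
  so agreement of those bits is equality of numbers; the tensor product then reassembles into a
  single label.\<close>

lemma toffoli_ket:
  assumes "n \<ge> 1" "q < 2 ^ n" "y < 2 ^ (n - 1)"
  shows "toffoli n y *\<^sub>v ket n q = ket n (if q div 2 = y then 2 * y + (1 - q mod 2) else q)"
proof -
  from \<open>n \<ge> 1\<close> obtain m where n: "n = Suc m" by (cases n) auto
  have d: "q div 2 < 2 ^ m" using assms n by auto
  have eq: "(\<forall>i<n - 1. bit y i = bit q (Suc i)) \<longleftrightarrow> q div 2 = y"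
    using nat_eq_iff_low_bits[of y m "q div 2"] assms d n by (auto simp: bit_Suc)
  have t: "ket (n - 1) (q div 2) \<otimes>\<^sub>v (pauli_X *\<^sub>v ket 1 (q mod 2)) =
      ket n (2 * (q div 2) + (1 - q mod 2))"
    using tensor_ket[OF d, of "1 - q mod 2" 1] pauli_X_ket[of "q mod 2"] n
    by (simp add: mult.commute)
  show ?thesis
    unfolding toffoli_def using assms(2) by (subst linear_extension_ket)
      (auto simp: eq t simp del: One_nat_def)
qed

section \<open>The gate \<open>U_gate\<close> on basis labels\<close>

lemma bit_foldr_flip_bit:
  fixes q :: nat
  assumes "distinct is"
  shows "bit (foldr flip_bit is q) k \<longleftrightarrow> (bit q k \<noteq> (k \<in> set is))"
  using assms by (induction "is") (auto simp: bit_flip_bit_iff)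

lemma foldr_flip_bit_less:
  assumes "q < 2 ^ n" "\<forall>i\<in>set is. i < n"
  shows "foldr flip_bit is q < (2::nat) ^ n"
  using assms by (induction "is") (auto simp: flip_bit_less)

lemma cnot_prod_carrier:
  "foldr (*) (map (\<lambda>i. cnot n n (n - i - 1)) is) (1\<^sub>m (2 ^ n)) \<in> carrier_mat (2 ^ n) (2 ^ n)"
  by (induction "is") (auto intro: mult_carrier_mat[OF cnot_carrier])

text \<open>The common control, qubit \<open>n\<close>, is bit 0, while the targets are the bits
  \<open>Suc i\<close>. No factor changes the parity of the label, so either all factors flip their
  target or none does.\<close>

lemma cnot_prod_ket:
  assumes "q < 2 ^ n" "\<forall>i\<in>set is. i < n - 1"
  shows "foldr (*) (map (\<lambda>i. cnot n n (n - i - 1)) is) (1\<^sub>m (2 ^ n)) *\<^sub>v ket n q =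
    ket n (if odd q then foldr flip_bit (map Suc is) q else q)"
  using assms(2)
proof (induction "is")
  case Nil
  then show ?case by simp
next
  case (Cons i "is")
  let ?r = "if odd q then foldr flip_bit (map Suc is) q else q"
  have r: "?r < 2 ^ n"
    using foldr_flip_bit_less[of q n "map Suc is"] assms(1) Cons.prems by fastforce
  have "even (flip_bit (Suc a) b) \<longleftrightarrow> even b" for a b :: nat
    using bit_flip_bit_iff[of "Suc a" b 0] by (simp add: bit_0)
  then have "even (foldr flip_bit (map Suc js) q) \<longleftrightarrow> even q" for js
    by (induction js) simp_all
  then have odd_r: "odd ?r \<longleftrightarrow> odd q" by simp
  \<comment> \<open>Qubit \<open>n - i - 1\<close> is bit \<open>Suc i\<close>; the truncated
    subtraction is exact because \<open>i < n - 1\<close>.\<close>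
  have i: "n - (n - i - 1) = Suc i" using Cons.prems by auto
  have "foldr (*) (map (\<lambda>i. cnot n n (n - i - 1)) (i # is)) (1\<^sub>m (2 ^ n)) *\<^sub>v ket n q =
      cnot n n (n - i - 1) *\<^sub>v ket n ?r"
    using Cons.IH Cons.prems
    by (simp add: assoc_mult_mat_vec[OF cnot_carrier cnot_prod_carrier ket_carrier]
        del: diff_diff_left One_nat_def)
  also have "\<dots> = ket n (if odd ?r then flip_bit (Suc i) ?r else ?r)"
    unfolding cnot_ket[OF r] i by (simp add: bit_0)
  finally show ?case unfolding odd_r by simp
qed

lemma finite_differing_bits [simp]: "finite (differing_bits n x)"
  by (simp add: differing_bits_def)

text \<open>Adding 1 to an even \<open>x\<close> changes bit 0 only, so the product has the single
  factor \<open>cnot n n (n - 1)\<close>. Both parities of \<open>x\<close> can thus be treated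
  alike.\<close>

lemma U_gate_eq_prod:
  assumes "n \<ge> 2"
  shows "U_gate n x =
    foldr (*) (map (\<lambda>i. cnot n n (n - i - 1)) (sorted_list_of_set (differing_bits n x)))
      (1\<^sub>m (2 ^ n))"
proof (cases "even x")
  case True
  have "bit (x + 1) i \<noteq> bit x i \<longleftrightarrow> i = 0" for i
    using True by (cases i) (auto simp: bit_Suc bit_0)
  then have "differing_bits n x = {i. i < n - 1 \<and> i = 0}"
    unfolding differing_bits_def by (simp only:)
  also have "\<dots> = {0}" using assms by auto
  finally have "differing_bits n x = {0}" .
  then show ?thesis
    using True by (simp add: U_gate_def right_mult_one_mat[OF cnot_carrier])
qed (simp add: U_gate_def)

lemma U_gate_carrier:
  assumes "n \<ge> 2"
  shows "U_gate n x \<in> carrier_mat (2 ^ n) (2 ^ n)"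
  unfolding U_gate_eq_prod[OF assms] by (rule cnot_prod_carrier)

text \<open>Neither \<open>x\<close> nor \<open>x + 1\<close> has a bit at position
  \<open>n - 1\<close> or above, so the set consists of all positions of ones in the XOR.\<close>

lemma differing_bits_iff:
  assumes "x + 1 < 2 ^ (n - 1)"
  shows "i \<in> differing_bits n x \<longleftrightarrow> bit (xor x (x + 1)) i"
proof -
  have "i < n - 1" if "bit y i" "y < 2 ^ (n - 1)" for y :: nat
    using that by (metis bit_take_bit_iff take_bit_nat_eq_self)
  then show ?thesis
    using assms unfolding differing_bits_def by (auto simp: bit_xor_iff simp del: add_Suc_right)
qed

text \<open>Flipping the positions \<open>Suc i\<close> for all differing \<open>i\<close> amounts
  to XORing \<open>q div 2\<close> with the mask of these \<open>i\<close>; bit 0 stays.\<close>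

lemma U_gate_ket:
  assumes "n \<ge> 2" "q < 2 ^ n" "x + 1 < 2 ^ (n - 1)"
  shows "U_gate n x *\<^sub>v ket n q =
    ket n (if odd q then 2 * xor (q div 2) (xor x (x + 1)) + 1 else q)"
proof -
  let ?is = "sorted_list_of_set (differing_bits n x)"
  have "foldr flip_bit (map Suc ?is) q = 2 * xor (q div 2) (xor x (x + 1)) + 1" if "odd q"
  proof (rule bit_eqI)
    fix k
    have "distinct (map Suc ?is)" by (simp add: distinct_map)
    note b = bit_foldr_flip_bit[OF this, of q k]
    show "bit (foldr flip_bit (map Suc ?is) q) k =
        bit (2 * xor (q div 2) (xor x (x + 1)) + 1) k"
    proof (cases k)
      case 0
      then show ?thesis using b that by (auto simp: bit_0)
    next
      case (Suc i)
      then show ?thesis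
        using b differing_bits_iff[OF assms(3), of i] by (auto simp: bit_Suc bit_xor_iff)
    qed
  qed
  moreover have "\<forall>i\<in>set ?is. i < n - 1" by (simp add: differing_bits_def)
  ultimately show ?thesis
    unfolding U_gate_eq_prod[OF assms(1)] using cnot_prod_ket[OF assms(2)] by simp
qed

section \<open>Conjugation of the Toffoli gate\<close>

lemma xor_nat_less:
  fixes a b :: nat
  assumes "a < 2 ^ m" "b < 2 ^ m"
  shows "xor a b < 2 ^ m"
  using assms by (metis take_bit_nat_eq_self take_bit_nat_less_exp take_bit_xor)

theorem theorem3p4:
  fixes n j x :: nat
  assumes "n \<ge> 2"
    and "j \<in> {0..2 ^ n - 1}"
    and "odd j"
    and "x < 2 ^ (n - 1)"
    and "j = 2 * x + 1"
    and "x \<noteq> (\<Sum>i<n - 1. 2 ^ i)"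
  shows "let G = U_gate n x * toffoli n (x + 1) * U_gate n x in
    unitary_gate n G \<and>
    implements n G (Transposition.transpose j (j + 1)) \<and>
    G *\<^sub>v ket n j = ket n (j + 1) \<and>
    G *\<^sub>v ket n (j + 1) = ket n j \<and>
    (\<forall>q \<in> {0..2 ^ n - 1} - {j, j + 1}. G *\<^sub>v ket n q = ket n q)"
proof -
  define m where "m = xor x (x + 1)"
  define u where "u q = (if odd q then 2 * xor (q div 2) m + 1 else q)" for q :: nat
  define t where
    "t q = (if q div 2 = x + 1 then 2 * (x + 1) + (1 - q mod 2) else q)" for q :: nat
  define G where "G = U_gate n x * toffoli n (x + 1) * U_gate n x"
  let ?s = "Transposition.transpose j (j + 1)"
  obtain k where n: "n = Suc k" using assms(1) by (cases n) auto
  \<comment> \<open>The all-one string is \<open>2 ^ k - 1\<close>; excluding it lets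
    \<open>x + 1\<close> fit into \<open>k\<close> bits.\<close>
  have "x \<noteq> 2 ^ k - 1"
    using assms(6) n mask_eq_sum_exp_nat[of k] by (simp add: lessThan_def)
  then have x1: "x + 1 < 2 ^ k" using assms(4) n by simp
  then have j: "j + 1 < 2 ^ n" using assms(5) n by simp
  have m: "m < 2 ^ k" unfolding m_def using x1 by (intro xor_nat_less) auto
  have u_less: "u q < 2 ^ n" if "q < 2 ^ n" for q
  proof -
    have "xor (q div 2) m < 2 ^ k" using m that n by (intro xor_nat_less) auto
    then show ?thesis using that n by (auto simp: u_def)
  qed
  have t_less: "t q < 2 ^ n" if "q < 2 ^ n" for q
    using that x1 n by (auto simp: t_def)
  have U: "implements n (U_gate n x) u"
    unfolding implements_def u_def m_def using U_gate_ket assms(1) x1 n by simp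
  have T: "implements n (toffoli n (x + 1)) t"
    unfolding implements_def t_def using toffoli_ket x1 n by simp
  have Uc: "U_gate n x \<in> carrier_mat (2 ^ n) (2 ^ n)"
    using U_gate_carrier assms(1) by simp
  have Tc: "toffoli n (x + 1) \<in> carrier_mat (2 ^ n) (2 ^ n)"
    by (simp add: toffoli_def)
  have Gc: "G \<in> carrier_mat (2 ^ n) (2 ^ n)"
    unfolding G_def using Uc Tc by (intro mult_carrier_mat)
  have cancel: "xor (xor z m) m = z" for z
    by (simp add: xor.assoc)
  \<comment> \<open>XOR with \<open>m\<close> exchanges \<open>x\<close> and
    \<open>x + 1\<close>.\<close>
  have mx: "xor x m = x + 1"
    unfolding m_def by (simp flip: xor.assoc)
  then have mx1: "xor (x + 1) m = x"
    using cancel[of x] by simp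
  have "u (t (u q)) = ?s q" for q
  proof (cases "odd q")
    case True
    then obtain z where q: "q = 2 * z + 1" by (elim oddE)
    show ?thesis
    proof (cases "z = x")
      case True
      \<comment> \<open>Here \<open>u\<close> sends \<open>j\<close> to
        \<open>2 * (x + 1) + 1\<close>, which \<open>t\<close> sends to the even label
        \<open>j + 1\<close>, fixed by \<open>u\<close>.\<close>
      then show ?thesis using mx assms(5) by (simp add: q u_def t_def)
    next
      case False
      \<comment> \<open>Hence \<open>t\<close> fixes \<open>u q\<close>, and the second
        \<open>u\<close> undoes the first.\<close>
      then have "xor z m \<noteq> x + 1" using cancel[of z] mx1 by auto
      then show ?thesis
        using False assms(5) cancel[of z]
        by (auto simp: q u_def t_def Transposition.transpose_def)
    qed
  next
    case False
    then obtain z where q: "q = 2 * z" by (auto elim: evenE)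
    show ?thesis
    proof (cases "z = x + 1")
      case True
      \<comment> \<open>The reverse route: \<open>u\<close> fixes \<open>j + 1\<close>,
        \<open>t\<close> makes it odd, and \<open>u\<close> carries the result to
        \<open>j\<close>.\<close>
      then show ?thesis using mx1 assms(5) by (simp add: q u_def t_def)
    next
      case False
      then show ?thesis
        using assms(5) by (auto simp: q u_def t_def Transposition.transpose_def)
    qed
  qed
  then have "u \<circ> t \<circ> u = ?s" by (simp add: fun_eq_iff)
  moreover have "implements n G (u \<circ> t \<circ> u)"
    unfolding G_def using Uc Tc U T t_less u_less
    by (intro implements_mult mult_carrier_mat) auto
  ultimately have impl: "implements n G ?s" by simp
  have "unitary_gate n G"
    using j by (intro unitary_gate_of_implements[OF Gc impl])
      (auto simp: Transposition.transpose_def inj_on_def)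
  moreover have "G *\<^sub>v ket n q = ket n (?s q)" if "q \<in> {0..2 ^ n - 1}" for q
  proof -
    have "q < 2 ^ n" using that by (simp add: le_diff_conv2 flip: Suc_le_eq)
    then show ?thesis using impl by (simp add: implements_def)
  qed
  ultimately show ?thesis
    unfolding Let_def G_def[symmetric] using impl j assms(2) by (auto simp: implements_def)
qed

end
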